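(* Let $r\ge0$ and let $f,g:(A,d_m^A)\to(B,d_m^B)$ be two morphisms of twisted complexes. Giving an $r$-homotopy $h$ from $f$ to $g$ is equivalent to giving a collection of morphisms $\widehat h_m:A\to B$, $m\ge0$, of bidegree $(-m+r,-m+r-1)$ such that for all $m\ge0$ $$\sum_{i+j=m}\Bigl((-1)^{i+r}d_i^B\widehat h_j+(-1)^i\widehat h_id_j^A\Bigr)=\begin{cases}0&\text{if }m<r,\\ g_{m-r}-f_{m-r}&\text{if }m\ge r.\end{cases}$$
   Context: $R$ is a commutative ring with unit. A bigraded module $A=\{A_i^j\}$ is a $(\mathbb Z,\mathbb Z)$-bigraded $R$-module; a map of bidegree $(p,q)$ sends $A_i^j$ to $A_{i+p}^{j+q}$. A twisted complex $(A,d_m)$ is a bigraded module $A$ with maps $d_m:A\to A$, $m\ge 0$, of bidegree $(-m,-m+1)$ such that $\sum_{i+j=m}(-1)^i d_id_j=0$ for all $m\ge0$. A morphism $f:(A,d^A_m)\to(B,d^B_m)$ is a family $f_m:A\to B$, $m\ge0$, of bidegree $(-m,-m)$ with $\sum_{i+j=m}d_i^Bf_j=\sum_{i+j=m}(-1)^if_id_j^A$ for all $m\geq0$. Composition is $(g\circ f)_m=\sum_{i+j=m}g_if_j$; a morphism is strict if $f_m=0$ for $m>0$. The $r$-path of $(B,d_m)$ is the twisted complex $P_r(B)_i^j:=B_i^j\oplus B_{i+r}^{j+r-1}\oplus B_i^j$ with $D_r(x,y,z)=(d_rx,-x-d_ry+z,d_rz)$ and $D_m(x,y,z)=(d_mx,(-1)^{m+r+1}d_my,d_mz)$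 for $m\ne r$; $\partial_B^-(x,y,z)=x$ and $\partial_B^+(x,y,z)=z$ are strict morphisms $P_r(B)\to B$. An $r$-homotopy from $f$ to $g$ is a morphism of twisted complexes $h:A\to P_r(B)$ with $\partial_B^-h=f$ and $\partial_B^+h=g$. *)

theory Defs
  imports "HOL-Algebra.Module" "HOL-Library.FuncSet"
begin

text \<open>Homomorphisms are taken extensional on the carrier, so that equality of HOL functions
  is equality of homomorphisms.\<close>

definition module_hom ::
  "('r, 's) ring_scheme \<Rightarrow> ('r, 'a, 'm) module_scheme \<Rightarrow> ('r, 'b, 'n) module_scheme \<Rightarrow> ('a \<Rightarrow> 'b) set"
  where "module_hom R M N = {\<phi> \<in> carrier M \<rightarrow>\<^sub>E carrier N.
     (\<forall>x\<in>carrier M. \<forall>y\<in>carrier M. \<phi> (x \<oplus>\<^bsub>M\<^esub> y) = \<phi> x \<oplus>\<^bsub>N\<^esub> \<phi> y) \<and>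
     (\<forall>a\<in>carrier R. \<forall>x\<in>carrier M. \<phi> (a \<odot>\<^bsub>M\<^esub> x) = a \<odot>\<^bsub>N\<^esub> \<phi> x)}"

text \<open>The fields \<open>mult\<close> and \<open>one\<close> of a module record play no role.\<close>

definition direct_sum :: "('r, 'a) module \<Rightarrow> ('r, 'b) module \<Rightarrow> ('r, 'a \<times> 'b) module"
    (infixr "\<oplus>\<oplus>" 65)
  where "M \<oplus>\<oplus> N =
   \<lparr>carrier = carrier M \<times> carrier N,
    mult = (\<lambda>(x, y) (x', y'). (x \<otimes>\<^bsub>M\<^esub> x', y \<otimes>\<^bsub>N\<^esub> y')),
    one = (\<one>\<^bsub>M\<^esub>, \<one>\<^bsub>N\<^esub>),
    zero = (\<zero>\<^bsub>M\<^esub>, \<zero>\<^bsub>N\<^esub>),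
    add = (\<lambda>(x, y) (x', y'). (x \<oplus>\<^bsub>M\<^esub> x', y \<oplus>\<^bsub>N\<^esub> y')),
    smult = (\<lambda>a (x, y). (a \<odot>\<^bsub>M\<^esub> x, a \<odot>\<^bsub>N\<^esub> y))\<rparr>"

text \<open>The module \<open>A i j\<close> is the component $A_i^j$. A map of bigraded modules is given by its
  components, so \<open>\<phi> i j\<close> is the restriction of \<open>\<phi>\<close> to $A_i^j$.\<close>

type_synonym ('r, 'a) bigraded = "int \<Rightarrow> int \<Rightarrow> ('r, 'a) module"
type_synonym ('a, 'b) bimap = "int \<Rightarrow> int \<Rightarrow> 'a \<Rightarrow> 'b"

definition bigraded_module :: "('r, 's) ring_scheme \<Rightarrow> ('r, 'a) bigraded \<Rightarrow> bool"
  where "bigraded_module R A \<longleftrightarrow> (\<forall>i j. module R (A i j))"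

definition bigraded_maps ::
  "('r, 's) ring_scheme \<Rightarrow> ('r, 'a) bigraded \<Rightarrow> ('r, 'b) bigraded \<Rightarrow> int \<Rightarrow> int \<Rightarrow> ('a, 'b) bimap set"
  where "bigraded_maps R A B p q = {\<phi>. \<forall>i j. \<phi> i j \<in> module_hom R (A i j) (B (i + p) (j + q))}"

record ('r, 'a) tw_data =
  piece :: "('r, 'a) bigraded"
  dmap :: "nat \<Rightarrow> ('a, 'a) bimap"

text \<open>A sum over $i+j=m$ is written as a sum over \<open>k \<le> m\<close> with $i=k$ and $j=m-k$.
  Signs are integer multiples \<open>[(-1)^k] \<cdot>\<^bsub>M\<^esub> x\<close>.\<close>

definition twisted_complex :: "('r, 's) ring_scheme \<Rightarrow> ('r, 'a) tw_data \<Rightarrow> bool"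
  where "twisted_complex R A \<longleftrightarrow>
    bigraded_module R (piece A) \<and>
    (\<forall>m. dmap A m \<in> bigraded_maps R (piece A) (piece A) (- int m) (- int m + 1)) \<and>
    (\<forall>m i j. \<forall>x\<in>carrier (piece A i j).
       (let T = piece A (i - int m) (j - int m + 2) in
        (\<Oplus>\<^bsub>T\<^esub> k\<in>{..m}. [((-1::int) ^ k)] \<cdot>\<^bsub>T\<^esub>
            (dmap A k (i - int (m - k)) (j - int (m - k) + 1) (dmap A (m - k) i j x))) = \<zero>\<^bsub>T\<^esub>))"

definition twisted_morphism ::
  "('r, 's) ring_scheme \<Rightarrow> ('r, 'a) tw_data \<Rightarrow> ('r, 'b) tw_data \<Rightarrow> (nat \<Rightarrow> ('a, 'b) bimap) \<Rightarrow> bool"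
  where "twisted_morphism R A B f \<longleftrightarrow>
    twisted_complex R A \<and> twisted_complex R B \<and>
    (\<forall>m. f m \<in> bigraded_maps R (piece A) (piece B) (- int m) (- int m)) \<and>
    (\<forall>m i j. \<forall>x\<in>carrier (piece A i j).
       (let T = piece B (i - int m) (j - int m + 1) in
        (\<Oplus>\<^bsub>T\<^esub> k\<in>{..m}. dmap B k (i - int (m - k)) (j - int (m - k)) (f (m - k) i j x)) =
        (\<Oplus>\<^bsub>T\<^esub> k\<in>{..m}. [((-1::int) ^ k)] \<cdot>\<^bsub>T\<^esub>
            (f k (i - int (m - k)) (j - int (m - k) + 1) (dmap A (m - k) i j x)))))"

definition twisted_compose ::
  "('r, 'a) tw_data \<Rightarrow> ('r, 'c) tw_data \<Rightarrow> (nat \<Rightarrow> ('b, 'c) bimap) \<Rightarrow> (nat \<Rightarrow> ('a, 'b) bimap)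
     \<Rightarrow> nat \<Rightarrow> ('a, 'c) bimap"
  where "twisted_compose A C g f m i j =
    (\<lambda>x\<in>carrier (piece A i j). \<Oplus>\<^bsub>piece C (i - int m) (j - int m)\<^esub> k\<in>{..m}.
        g k (i - int (m - k)) (j - int (m - k)) (f (m - k) i j x))"

definition path_comp :: "nat \<Rightarrow> ('r, 'b) tw_data \<Rightarrow> ('r, 'b \<times> 'b \<times> 'b) bigraded"
  where "path_comp r B i j =
    piece B i j \<oplus>\<oplus> piece B (i + int r) (j + int r - 1) \<oplus>\<oplus> piece B i j"

definition path_diff :: "nat \<Rightarrow> ('r, 'b) tw_data \<Rightarrow> nat \<Rightarrow> ('b \<times> 'b \<times> 'b, 'b \<times> 'b \<times> 'b) bimap"
  where "path_diff r B m i j =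
    (\<lambda>(x, y, z)\<in>carrier (path_comp r B i j).
       (let T = piece B (i - int m + int r) (j - int m + int r);
            dy = dmap B m (i + int r) (j + int r - 1) y
        in (dmap B m i j x,
            if m = r then (\<ominus>\<^bsub>T\<^esub> x) \<ominus>\<^bsub>T\<^esub> dy \<oplus>\<^bsub>T\<^esub> z
            else [((-1::int) ^ (m + r + 1))] \<cdot>\<^bsub>T\<^esub> dy,
            dmap B m i j z)))"

definition path_complex :: "nat \<Rightarrow> ('r, 'b) tw_data \<Rightarrow> ('r, 'b \<times> 'b \<times> 'b) tw_data"
  where "path_complex r B = \<lparr>piece = path_comp r B, dmap = path_diff r B\<rparr>"

text \<open>A map of bigraded modules of bidegree $(0,0)$, viewed as a strict morphism.\<close>

definition strict_family ::
  "('r, 'a) tw_data \<Rightarrow> ('r, 'b) tw_data \<Rightarrow> ('a \<Rightarrow> 'b) \<Rightarrow> nat \<Rightarrow> ('a, 'b) bimap"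
  where "strict_family A B \<phi> m i j =
    (\<lambda>x\<in>carrier (piece A i j). if m = 0 then \<phi> x else \<zero>\<^bsub>piece B (i - int m) (j - int m)\<^esub>)"

definition path_minus :: "nat \<Rightarrow> ('r, 'b) tw_data \<Rightarrow> nat \<Rightarrow> ('b \<times> 'b \<times> 'b, 'b) bimap"
  where "path_minus r B = strict_family (path_complex r B) B (\<lambda>(x, y, z). x)"

definition path_plus :: "nat \<Rightarrow> ('r, 'b) tw_data \<Rightarrow> nat \<Rightarrow> ('b \<times> 'b \<times> 'b, 'b) bimap"
  where "path_plus r B = strict_family (path_complex r B) B (\<lambda>(x, y, z). z)"

definition r_homotopy ::
  "('r, 's) ring_scheme \<Rightarrow> nat \<Rightarrow> ('r, 'a) tw_data \<Rightarrow> ('r, 'b) tw_data \<Rightarrow>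
   (nat \<Rightarrow> ('a, 'b) bimap) \<Rightarrow> (nat \<Rightarrow> ('a, 'b) bimap) \<Rightarrow> (nat \<Rightarrow> ('a, 'b \<times> 'b \<times> 'b) bimap) \<Rightarrow> bool"
  where "r_homotopy R r A B f g h \<longleftrightarrow>
    twisted_morphism R A (path_complex r B) h \<and>
    twisted_compose A B (path_minus r B) h = f \<and>
    twisted_compose A B (path_plus r B) h = g"

text \<open>The middle components $A_i^j \to B_{i-m+r}^{j-m+r-1}$ of $h_m : A_i^j \to P_r(B)_{i-m}^{j-m}$.\<close>

definition middle_component ::
  "('r, 'a) tw_data \<Rightarrow> (nat \<Rightarrow> ('a, 'b \<times> 'b \<times> 'b) bimap) \<Rightarrow> nat \<Rightarrow> ('a, 'b) bimap"
  where "middle_component A h m i j = (\<lambda>x\<in>carrier (piece A i j). case h m i j x of (u, v, w) \<Rightarrow> v)"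

end

theory Submission
  imports Defs
begin

text \<open>A family of maps \<open>h\<^sub>m : A \<rightarrow> P\<^sub>r(B)\<close> is a triple of families, and the end point conditions say that
  its outer components are \<open>f\<close> and \<open>g\<close>. The outer components of the morphism equation for \<open>h\<close> are
  then the morphism equations for \<open>f\<close> and \<open>g\<close>. Writing the middle component of \<open>D\<^sub>m(x, y, z)\<close> uniformly
  as $(-1)^{m+r+1} d_m y + [m = r](z - x)$, the middle component of the morphism equation becomes
  the displayed equation for \<open>h'\<close>. The same formula shows that \<open>P\<^sub>r(B)\<close> is a twisted complex: in
  the middle component of $\sum_k (-1)^k D_k D_{m-k}$ the terms coming from $z - x$ occur for
  $k = r$ and $k = m - r$, with opposite signs.\<close>

section \<open>Signed sums in abelian groups\<close>

lemma (in abelian_group) int_smult_minus_one: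
  assumes "x \<in> carrier G"
  shows "[(-1::int)] \<cdot> x = \<ominus> x"
  using add.int_pow_neg[of x 1] assms by simp

lemma (in abelian_group) finsum_int_smult:
  fixes n :: int
  assumes "F \<in> X \<rightarrow> carrier G"
  shows "(\<Oplus>k\<in>X. [n] \<cdot> F k) = [n] \<cdot> (\<Oplus>k\<in>X. F k)"
  using assms
proof (induction X rule: infinite_finite_induct)
  case (insert x X)
  then have "F x \<in> carrier G" "F \<in> X \<rightarrow> carrier G" by auto
  moreover from this have "(\<lambda>k. [n] \<cdot> F k) \<in> X \<rightarrow> carrier G" by auto
  ultimately show ?case
    using insert by (simp add: add.int_pow_distrib)
qed auto

text \<open>Membership of \<open>c\<close> is assumed only when \<open>l\<close> lies in
  \<open>X\<close>. The main use has \<open>l = r\<close> and \<open>X = {..m}\<close>, with a term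
  \<open>c\<close> built from index \<open>m - r\<close>, which is known to lie in the right
  component only for \<open>r \<le> m\<close>.\<close>

lemma (in abelian_monoid) finsum_at:
  assumes "finite X" and "l \<in> X \<Longrightarrow> c \<in> carrier G"
  shows "(\<Oplus>k\<in>X. if k = l then c else \<zero>) = (if l \<in> X then c else \<zero>)"
proof (cases "l \<in> X")
  case True
  have "(\<Oplus>k\<in>X. if l = k then c else \<zero>) = c"
    using finsum_singleton[of l X "\<lambda>_. c"] assms True by simp
  moreover have "(\<lambda>k. if k = l then c else \<zero>) = (\<lambda>k. if l = k then c else \<zero>)" by auto
  ultimately show ?thesis using True by simp
next
  case False
  have "(\<Oplus>k\<in>X. if k = l then c else \<zero>) = (\<Oplus>k\<in>X. \<zero>)"
    using False by (intro finsum_cong') auto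
  then show ?thesis using False by simp
qed

text \<open>To be read with u_k = d_k h'_{m-k} y, v_k = h'_k d_{m-k} y and w = (g_{m-r} - f_{m-r}) y
  for an element y of A. The extra factor -1 in the first sign comes out of the sum, and the term at
  k = r contributes W, which is w or zero. The first equation then reads -U + W = V, the second U +
  V = W.\<close>

lemma (in abelian_group) middle_equation_iff:
  fixes m r :: nat
  assumes u: "u \<in> {..m} \<rightarrow> carrier G" and v: "v \<in> {..m} \<rightarrow> carrier G"
    and w: "r \<le> m \<Longrightarrow> w \<in> carrier G"
  shows "(\<Oplus>k\<in>{..m}. [((-1::int) ^ (k + r + 1))] \<cdot> u k \<oplus> (if k = r then w else \<zero>)) =
           (\<Oplus>k\<in>{..m}. [((-1::int) ^ k)] \<cdot> v k) \<longleftrightarrow>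
         (\<Oplus>k\<in>{..m}. [((-1::int) ^ (k + r))] \<cdot> u k \<oplus> [((-1::int) ^ k)] \<cdot> v k) =
           (if m < r then \<zero> else w)"
proof -
  let ?U = "\<Oplus>k\<in>{..m}. [((-1::int) ^ (k + r))] \<cdot> u k"
  let ?V = "\<Oplus>k\<in>{..m}. [((-1::int) ^ k)] \<cdot> v k"
  let ?W = "if m < r then \<zero> else w"
  have U: "?U \<in> carrier G" and V: "?V \<in> carrier G" and W: "?W \<in> carrier G"
    using u v w by (auto intro!: finsum_closed)
  \<comment> \<open>Negation is written as multiplication by the integer -1, so that
    \<open>finsum_int_smult\<close> can move it across the sum.\<close>
  have "(\<Oplus>k\<in>{..m}. [((-1::int) ^ (k + r + 1))] \<cdot> u k) =
        (\<Oplus>k\<in>{..m}. [(-1::int)] \<cdot> ([((-1::int) ^ (k + r))] \<cdot> u k))"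
    using u by (intro finsum_cong') (auto simp: add.int_pow_pow Pi_def)
  also have "\<dots> = \<ominus> ?U"
    using u U by (subst finsum_int_smult) (auto simp: int_smult_minus_one)
  finally have neg: "(\<Oplus>k\<in>{..m}. [((-1::int) ^ (k + r + 1))] \<cdot> u k) = \<ominus> ?U" .
  have "(\<Oplus>k\<in>{..m}. [((-1::int) ^ (k + r + 1))] \<cdot> u k \<oplus> (if k = r then w else \<zero>)) =
        (\<Oplus>k\<in>{..m}. [((-1::int) ^ (k + r + 1))] \<cdot> u k) \<oplus> (\<Oplus>k\<in>{..m}. if k = r then w else \<zero>)"
    using u w by (intro finsum_addf) auto
  then have "(\<Oplus>k\<in>{..m}. [((-1::int) ^ (k + r + 1))] \<cdot> u k \<oplus> (if k = r then w else \<zero>)) =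
        \<ominus> ?U \<oplus> ?W"
    using w finsum_at[of "{..m}" r w] unfolding neg by (simp add: not_less)
  moreover have "(\<Oplus>k\<in>{..m}. [((-1::int) ^ (k + r))] \<cdot> u k \<oplus> [((-1::int) ^ k)] \<cdot> v k) = ?U \<oplus> ?V"
    using u v by (intro finsum_addf) auto
  moreover have "\<ominus> ?U \<oplus> ?W = ?V \<longleftrightarrow> ?U \<oplus> ?V = ?W"
    using add.inv_solve_left[OF V U W] by auto
  ultimately show ?thesis by simp
qed

text \<open>This is the middle component of the square-zero equation of the path complex, with u_k =
  d_k d_{m-k} y and e = d_{m-r}(z - x). The signs of u_k multiply to (-1)^m (-1)^k, so these terms
  add up to a multiple of the vanishing sum. The first occurrence of e has sign (-1)^(r+1), the
  second (-1)^r, hence they cancel. The two may share an index, when m = 2r; they are therefore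
  summed separately.\<close>

lemma (in abelian_group) path_square_sum:
  fixes m r :: nat
  assumes u: "u \<in> {..m} \<rightarrow> carrier G" and e: "r \<le> m \<Longrightarrow> e \<in> carrier G"
    and u0: "(\<Oplus>k\<in>{..m}. [((-1::int) ^ k)] \<cdot> u k) = \<zero>"
  shows "(\<Oplus>k\<in>{..m}. [((-1::int) ^ k)] \<cdot>
            ([((-1::int) ^ (k + r + 1))] \<cdot>
               ([((-1::int) ^ (m - k + r + 1))] \<cdot> u k \<oplus> (if m - k = r then e else \<zero>))
             \<oplus> (if k = r then e else \<zero>))) = \<zero>"
proof -
  let ?s = "\<lambda>n::nat. (-1::int) ^ n"
  \<comment> \<open>The condition \<open>m - k = r\<close> is solved for \<open>k\<close> to fit
    \<open>finsum_at\<close>. As subtraction on naturals truncates, \<open>k = m - r\<close> would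
    wrongly hold at \<open>k = 0\<close> when \<open>m < r\<close>; the inner test
    \<open>r \<le> m\<close> removes that case.\<close>
  have step: "[?s k] \<cdot> ([?s (k + r + 1)] \<cdot>
               ([?s (m - k + r + 1)] \<cdot> u k \<oplus> (if m - k = r then e else \<zero>))
             \<oplus> (if k = r then e else \<zero>)) =
        ([?s m] \<cdot> ([?s k] \<cdot> u k)) \<oplus>
          ((if k = m - r then (if r \<le> m then [?s (r + 1)] \<cdot> e else \<zero>) else \<zero>)
           \<oplus> (if k = r then [?s r] \<cdot> e else \<zero>))"
    if k: "k \<le> m" for k
  proof -
    have uk: "u k \<in> carrier G" using u k by auto
    have e1: "(if m - k = r then e else \<zero>) \<in> carrier G" "(if k = r then e else \<zero>) \<in> carrier G"
      using e k by auto
    have "?s k * (?s (k + r + 1) * ?s (m - k + r + 1)) = ?s m * ?s k"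
    proof -
      have "k + ((k + r + 1) + (m - k + r + 1)) = (m + k) + 2 * (r + 1)" using k by simp
      then show ?thesis by (metis power_add power_minus1_even mult.right_neutral)
    qed
    then have 1: "[?s k] \<cdot> ([?s (k + r + 1)] \<cdot> ([?s (m - k + r + 1)] \<cdot> u k)) = [?s m] \<cdot> ([?s k] \<cdot> u k)"
      using uk by (simp add: add.int_pow_pow mult_ac del: power_Suc)
    have "?s k * ?s (k + r + 1) = ?s (r + 1)"
      by (metis add.assoc left_minus_one_mult_self power_add)
    then have 2: "[?s k] \<cdot> ([?s (k + r + 1)] \<cdot> (if m - k = r then e else \<zero>)) =
        (if k = m - r then (if r \<le> m then [?s (r + 1)] \<cdot> e else \<zero>) else \<zero>)"
      using e k by (auto simp add: add.int_pow_pow mult_ac simp del: power_Suc)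
    show ?thesis
      using 1 2 uk e1 by (simp add: add.int_pow_distrib a_assoc del: power_Suc)
  qed
  have u': "u k \<in> carrier G" if "k \<le> m" for k using u that by auto
  have "(\<Oplus>k\<in>{..m}. [?s k] \<cdot> ([?s (k + r + 1)] \<cdot>
               ([?s (m - k + r + 1)] \<cdot> u k \<oplus> (if m - k = r then e else \<zero>))
             \<oplus> (if k = r then e else \<zero>))) =
      (\<Oplus>k\<in>{..m}. ([?s m] \<cdot> ([?s k] \<cdot> u k)) \<oplus>
          ((if k = m - r then (if r \<le> m then [?s (r + 1)] \<cdot> e else \<zero>) else \<zero>)
           \<oplus> (if k = r then [?s r] \<cdot> e else \<zero>)))"
  proof (rule finsum_cong')
    show "(\<lambda>k. ([?s m] \<cdot> ([?s k] \<cdot> u k)) \<oplus>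
          ((if k = m - r then (if r \<le> m then [?s (r + 1)] \<cdot> e else \<zero>) else \<zero>)
           \<oplus> (if k = r then [?s r] \<cdot> e else \<zero>))) \<in> {..m} \<rightarrow> carrier G"
      using u' e by (auto simp: Pi_iff)
  qed (rule refl, rule step, simp)
  also have "\<dots> = (\<Oplus>k\<in>{..m}. [?s m] \<cdot> ([?s k] \<cdot> u k)) \<oplus>
      ((\<Oplus>k\<in>{..m}. if k = m - r then (if r \<le> m then [?s (r + 1)] \<cdot> e else \<zero>) else \<zero>) \<oplus>
       (\<Oplus>k\<in>{..m}. if k = r then [?s r] \<cdot> e else \<zero>))"
    (is "_ = ?X \<oplus> (finsum G ?y _ \<oplus> finsum G ?z _)")
  proof -
    have y: "?y \<in> {..m} \<rightarrow> carrier G" and z: "?z \<in> {..m} \<rightarrow> carrier G"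
      and x: "(\<lambda>k. [?s m] \<cdot> ([?s k] \<cdot> u k)) \<in> {..m} \<rightarrow> carrier G"
      using u' e by auto
    then have yz: "(\<lambda>k. ?y k \<oplus> ?z k) \<in> {..m} \<rightarrow> carrier G"
      by (intro Pi_I a_closed) (auto dest: Pi_mem)
    show ?thesis
      unfolding finsum_addf[OF x yz] finsum_addf[OF y z] ..
  qed
  also have "?X = [?s m] \<cdot> (\<Oplus>k\<in>{..m}. [?s k] \<cdot> u k)"
    using u' by (intro finsum_int_smult) auto
  also have "\<dots> = \<zero>" using u0 by simp
  also have "finsum G ?y {..m} = (if r \<le> m then [?s (r + 1)] \<cdot> e else \<zero>)"
    using e by (subst finsum_at) auto
  also have "finsum G ?z {..m} = (if r \<le> m then [?s r] \<cdot> e else \<zero>)"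
    using e by (subst finsum_at) auto
  also have "\<zero> \<oplus> ((if r \<le> m then [?s (r + 1)] \<cdot> e else \<zero>) \<oplus> (if r \<le> m then [?s r] \<cdot> e else \<zero>)) = \<zero>"
    using e by (simp add: add.int_pow_neg l_neg)
  finally show ?thesis .
qed

section \<open>Direct sums and module homomorphisms\<close>

lemma direct_sum_simps:
  "carrier (M \<oplus>\<oplus> N) = carrier M \<times> carrier N"
  "\<zero>\<^bsub>M \<oplus>\<oplus> N\<^esub> = (\<zero>\<^bsub>M\<^esub>, \<zero>\<^bsub>N\<^esub>)"
  "(x, y) \<oplus>\<^bsub>M \<oplus>\<oplus> N\<^esub> (x', y') = (x \<oplus>\<^bsub>M\<^esub> x', y \<oplus>\<^bsub>N\<^esub> y')"
  "a \<odot>\<^bsub>M \<oplus>\<oplus> N\<^esub> (x, y) = (a \<odot>\<^bsub>M\<^esub> x, a \<odot>\<^bsub>N\<^esub> y)"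
  by (simp_all add: direct_sum_def)

lemma module_direct_sum:
  assumes "module R M" and "module R N"
  shows "module R (M \<oplus>\<oplus> N)"
proof -
  interpret M: module R M by fact
  interpret N: module R N by fact
  show ?thesis
  proof (rule moduleI)
    show "abelian_group (M \<oplus>\<oplus> N)"
    proof (rule abelian_groupI)
      fix x assume "x \<in> carrier (M \<oplus>\<oplus> N)"
      then show "\<exists>y\<in>carrier (M \<oplus>\<oplus> N). y \<oplus>\<^bsub>M \<oplus>\<oplus> N\<^esub> x = \<zero>\<^bsub>M \<oplus>\<oplus> N\<^esub>"
        by (intro bexI[of _ "(\<ominus>\<^bsub>M\<^esub> fst x, \<ominus>\<^bsub>N\<^esub> snd x)"])
          (auto simp: direct_sum_simps M.M.l_neg N.M.l_neg)
    qed (auto simp: direct_sum_simps M.M.a_ac N.M.a_ac)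
  qed (auto simp: direct_sum_simps M.smult_l_distr N.smult_l_distr M.smult_r_distr N.smult_r_distr
        M.smult_assoc1 N.smult_assoc1 intro: M.R.is_cring)
qed

lemma finsum_direct_sum:
  assumes "module R M" and "module R N"
    and "F \<in> X \<rightarrow> carrier M" and "G \<in> X \<rightarrow> carrier N"
  shows "(\<Oplus>\<^bsub>M \<oplus>\<oplus> N\<^esub> k\<in>X. (F k, G k)) = (\<Oplus>\<^bsub>M\<^esub> k\<in>X. F k, \<Oplus>\<^bsub>N\<^esub> k\<in>X. G k)"
proof -
  interpret M: module R M by fact
  interpret N: module R N by fact
  interpret MN: module R "M \<oplus>\<oplus> N" using assms by (intro module_direct_sum)
  show ?thesis using assms(3,4)
  proof (induction X rule: infinite_finite_induct)
    case (insert x X)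
    then have "F x \<in> carrier M" "F \<in> X \<rightarrow> carrier M" "G x \<in> carrier N" "G \<in> X \<rightarrow> carrier N"
      by auto
    moreover from this have "(\<lambda>k. (F k, G k)) \<in> X \<rightarrow> carrier (M \<oplus>\<oplus> N)"
      by (auto simp: direct_sum_simps)
    ultimately show ?case
      using insert by (simp add: direct_sum_simps)
  qed (auto simp: direct_sum_simps)
qed

text \<open>Integer multiples are powers in the additive group, so additive maps respect them. Bare
  additive maps cover three uses at once: projections of a direct sum, module homomorphisms, and
  multiplication by a fixed scalar.\<close>

lemma abelian_group_int_smult_hom:
  fixes n :: int
  assumes "abelian_group M" and "abelian_group N"
    and cl: "\<And>x. x \<in> carrier M \<Longrightarrow> \<phi> x \<in> carrier N"
    and add: "\<And>x y. x \<in> carrier M \<Longrightarrow> y \<in> carrier M \<Longrightarrow> \<phi> (x \<oplus>\<^bsub>M\<^esub> y) = \<phi> x \<oplus>\<^bsub>N\<^esub> \<phi> y"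
    and x: "x \<in> carrier M"
  shows "\<phi> ([n] \<cdot>\<^bsub>M\<^esub> x) = [n] \<cdot>\<^bsub>N\<^esub> \<phi> x"
proof -
  interpret M: abelian_group M by fact
  interpret N: abelian_group N by fact
  have "\<phi> \<in> hom (add_monoid M) (add_monoid N)"
    using cl add by (auto simp: hom_def)
  then show ?thesis
    using hom_int_pow[of \<phi> "add_monoid M" "add_monoid N" x n] x
    by (simp add: M.a_group N.a_group add_pow_def)
qed

text \<open>Both projections are additive, so each of them carries an integer multiple of the pair
  to the same multiple of its entry.\<close>

lemma int_smult_direct_sum:
  fixes n :: int
  assumes "module R M" and "module R N" and "x \<in> carrier M" and "y \<in> carrier N"
  shows "[n] \<cdot>\<^bsub>M \<oplus>\<oplus> N\<^esub> (x, y) = ([n] \<cdot>\<^bsub>M\<^esub> x, [n] \<cdot>\<^bsub>N\<^esub> y)"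
proof -
  interpret M: module R M by fact
  interpret N: module R N by fact
  interpret MN: module R "M \<oplus>\<oplus> N" using assms by (intro module_direct_sum)
  have "fst ([n] \<cdot>\<^bsub>M \<oplus>\<oplus> N\<^esub> (x, y)) = [n] \<cdot>\<^bsub>M\<^esub> fst (x, y)"
    by (rule abelian_group_int_smult_hom[OF MN.abelian_group_axioms M.abelian_group_axioms])
      (auto simp: direct_sum_simps assms)
  moreover have "snd ([n] \<cdot>\<^bsub>M \<oplus>\<oplus> N\<^esub> (x, y)) = [n] \<cdot>\<^bsub>N\<^esub> snd (x, y)"
    by (rule abelian_group_int_smult_hom[OF MN.abelian_group_axioms N.abelian_group_axioms])
      (auto simp: direct_sum_simps assms)
  ultimately show ?thesis by (metis fst_conv snd_conv prod.collapse)
qed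

text \<open>The shape M, N, M is that of a component of \<open>path_comp\<close>. With
  \<open>finsum_triple\<close> it lets signed sums there be computed entry by entry.\<close>

lemma int_smult_triple:
  fixes n :: int
  assumes "module R M" and "module R N" and "x \<in> carrier M" and "y \<in> carrier N" and "z \<in> carrier M"
  shows "[n] \<cdot>\<^bsub>M \<oplus>\<oplus> N \<oplus>\<oplus> M\<^esub> (x, y, z) = ([n] \<cdot>\<^bsub>M\<^esub> x, [n] \<cdot>\<^bsub>N\<^esub> y, [n] \<cdot>\<^bsub>M\<^esub> z)"
  using int_smult_direct_sum[OF assms(1) module_direct_sum[OF assms(2,1)], of x "(y, z)"]
    int_smult_direct_sum[OF assms(2,1)] assms(3-) by (simp add: direct_sum_simps)

lemma finsum_triple:
  assumes "module R M" and "module R N"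
    and "F \<in> X \<rightarrow> carrier M" and "G \<in> X \<rightarrow> carrier N" and "H \<in> X \<rightarrow> carrier M"
  shows "(\<Oplus>\<^bsub>M \<oplus>\<oplus> N \<oplus>\<oplus> M\<^esub> k\<in>X. (F k, G k, H k)) =
    (\<Oplus>\<^bsub>M\<^esub> k\<in>X. F k, \<Oplus>\<^bsub>N\<^esub> k\<in>X. G k, \<Oplus>\<^bsub>M\<^esub> k\<in>X. H k)"
  using finsum_direct_sum[OF assms(1) module_direct_sum[OF assms(2,1)] assms(3), of "\<lambda>k. (G k, H k)"]
    finsum_direct_sum[OF assms(2,1,4,5)] assms(4,5) by (simp add: direct_sum_simps Pi_iff)

section \<open>Homomorphisms, integer multiples, and maps into a direct sum\<close>

lemma module_hom_closed:
  "\<phi> \<in> module_hom R M N \<Longrightarrow> x \<in> carrier M \<Longrightarrow> \<phi> x \<in> carrier N"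
  by (auto simp: module_hom_def)

lemma module_hom_add:
  "\<phi> \<in> module_hom R M N \<Longrightarrow> x \<in> carrier M \<Longrightarrow> y \<in> carrier M \<Longrightarrow> \<phi> (x \<oplus>\<^bsub>M\<^esub> y) = \<phi> x \<oplus>\<^bsub>N\<^esub> \<phi> y"
  by (auto simp: module_hom_def)

lemma module_hom_smult:
  "\<phi> \<in> module_hom R M N \<Longrightarrow> a \<in> carrier R \<Longrightarrow> x \<in> carrier M \<Longrightarrow> \<phi> (a \<odot>\<^bsub>M\<^esub> x) = a \<odot>\<^bsub>N\<^esub> \<phi> x"
  by (auto simp: module_hom_def)

lemma module_hom_int_smult:
  fixes n :: int
  assumes "module R M" and "module R N" and "\<phi> \<in> module_hom R M N" and "x \<in> carrier M"
  shows "\<phi> ([n] \<cdot>\<^bsub>M\<^esub> x) = [n] \<cdot>\<^bsub>N\<^esub> \<phi> x"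
  using assms
  by (intro abelian_group_int_smult_hom) (simp_all add: module_hom_closed module_hom_add module.axioms(2))

lemma module_hom_zero:
  assumes "module R M" and "module R N" and "\<phi> \<in> module_hom R M N"
  shows "\<phi> \<zero>\<^bsub>M\<^esub> = \<zero>\<^bsub>N\<^esub>"
proof -
  interpret M: module R M by fact
  interpret N: module R N by fact
  show ?thesis
    using module_hom_add[OF assms(3), of "\<zero>\<^bsub>M\<^esub>" "\<zero>\<^bsub>M\<^esub>"] module_hom_closed[OF assms(3), of "\<zero>\<^bsub>M\<^esub>"]
    by simp
qed

lemma module_hom_diff:
  assumes "module R M" and "module R N" and "\<phi> \<in> module_hom R M N"
    and "x \<in> carrier M" and "y \<in> carrier M"
  shows "\<phi> (x \<ominus>\<^bsub>M\<^esub> y) = \<phi> x \<ominus>\<^bsub>N\<^esub> \<phi> y"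
proof -
  interpret M: module R M by fact
  interpret N: module R N by fact
  show ?thesis
    using module_hom_int_smult[OF assms(1-3), of y "-1"] assms
    by (simp add: a_minus_def module_hom_add module_hom_closed M.M.int_smult_minus_one
        N.M.int_smult_minus_one)
qed

text \<open>All conditions are tested on \<open>carrier M\<close>, which is closed under the
  operations, so \<open>restrict\<close> can be evaluated wherever it occurs. Applied twice, this
  splits a map into the path complex into its three components.\<close>

lemma restrict_pair_module_hom_iff:
  "(\<lambda>x\<in>carrier M. (\<phi> x, \<psi> x)) \<in> module_hom R M (N \<oplus>\<oplus> P) \<longleftrightarrow>
   restrict \<phi> (carrier M) \<in> module_hom R M N \<and> restrict \<psi> (carrier M) \<in> module_hom R M P"
  if "module R M"
proof -
  interpret M: module R M by fact
  show ?thesis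
    by (auto simp: module_hom_def direct_sum_simps Pi_iff)
qed


section \<open>The path complex\<close>

text \<open>The target degrees are variables tied down by equations. Degrees reached along different
  routes, such as i - (m - k) - k and i - m, agree only after integer arithmetic, and this form
  turns each mismatch into a side goal. \<open>dmap_hom\<close> and \<open>path_comp_eq\<close>
  follow the same pattern.\<close>

lemma bigraded_map_hom:
  "\<phi> \<in> bigraded_maps R A B p q \<Longrightarrow> i' = i + p \<Longrightarrow> j' = j + q \<Longrightarrow>
   \<phi> i j \<in> module_hom R (A i j) (B i' j')"
  by (simp add: bigraded_maps_def)

lemma piece_module: "twisted_complex R A \<Longrightarrow> module R (piece A i j)"
  by (simp add: twisted_complex_def bigraded_module_def)

lemma dmap_hom:
  "twisted_complex R A \<Longrightarrow> i' = i - int m \<Longrightarrow> j' = j - int m + 1 \<Longrightarrow>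
   dmap A m i j \<in> module_hom R (piece A i j) (piece A i' j')"
  by (auto simp: twisted_complex_def intro: bigraded_map_hom)

text \<open>The intermediate degrees depend on the summation index, so they enter as functions that
  need to be correct only for \<open>k \<le> m\<close>. This makes the square-zero equation of
  \<open>A\<close> applicable to sums whose degrees are written differently, as happens in the
  shifted middle component of the path complex.\<close>

lemma dmap_square:
  assumes "twisted_complex R A" and "x \<in> carrier (piece A i j)"
    and "T = piece A (i - int m) (j - int m + 2)"
    and "\<And>k. k \<le> m \<Longrightarrow> i' k = i - int (m - k)"
    and "\<And>k. k \<le> m \<Longrightarrow> j' k = j - int (m - k) + 1"
  shows "(\<Oplus>\<^bsub>T\<^esub> k\<in>{..m}. [((-1::int) ^ k)] \<cdot>\<^bsub>T\<^esub> dmap A k (i' k) (j' k) (dmap A (m - k) i j x)) = \<zero>\<^bsub>T\<^esub>"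
proof -
  interpret T: module R T using assms(1,3) by (simp add: piece_module)
  have "dmap A k (i' k) (j' k) (dmap A (m - k) i j x) \<in> carrier T" if "k \<le> m" for k
  proof -
    have "dmap A (m - k) i j x \<in> carrier (piece A (i' k) (j' k))"
      using assms(2) that by (intro module_hom_closed[OF dmap_hom[OF assms(1)]]) (auto simp: assms(4,5))
    then show ?thesis
      unfolding assms(3)
      using that by (intro module_hom_closed[OF dmap_hom[OF assms(1)]]) (auto simp: assms of_nat_diff)
  qed
  then have "(\<Oplus>\<^bsub>T\<^esub> k\<in>{..m}. [((-1::int) ^ k)] \<cdot>\<^bsub>T\<^esub> dmap A k (i' k) (j' k) (dmap A (m - k) i j x)) =
        (\<Oplus>\<^bsub>T\<^esub> k\<in>{..m}. [((-1::int) ^ k)] \<cdot>\<^bsub>T\<^esub>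
           dmap A k (i - int (m - k)) (j - int (m - k) + 1) (dmap A (m - k) i j x))"
    using assms(4,5) by (intro T.M.finsum_cong') (auto simp: Pi_def)
  also have "\<dots> = \<zero>\<^bsub>T\<^esub>"
    using assms(1,2) unfolding twisted_complex_def assms(3) Let_def by blast
  finally show ?thesis .
qed

lemma path_comp_eq:
  "i' = i + int r \<Longrightarrow> j' = j + int r - 1 \<Longrightarrow>
   path_comp r B i j = piece B i j \<oplus>\<oplus> piece B i' j' \<oplus>\<oplus> piece B i j"
  by (simp add: path_comp_def)

lemma path_comp_module: "twisted_complex R B \<Longrightarrow> module R (path_comp r B i j)"
  by (simp add: path_comp_def module_direct_sum piece_module)

text \<open>This merges the two branches of the definition. For m = r the sign (-1)^(2r+1) is -1 and
  \<open>T\<close> is the component of \<open>x\<close> and \<open>z\<close> itself, so z - x can be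
  formed there; for other m the second summand is zero.\<close>

lemma path_diff_apply:
  assumes B: "twisted_complex R B"
    and x: "x \<in> carrier (piece B i j)" and z: "z \<in> carrier (piece B i j)"
    and y: "y \<in> carrier (piece B i' j')"
    and i': "i' = i + int r" and j': "j' = j + int r - 1"
    and T: "T = piece B (i - int m + int r) (j - int m + int r)"
  shows "path_diff r B m i j (x, y, z) =
    (dmap B m i j x,
     [((-1::int) ^ (m + r + 1))] \<cdot>\<^bsub>T\<^esub> dmap B m i' j' y \<oplus>\<^bsub>T\<^esub> (if m = r then z \<ominus>\<^bsub>T\<^esub> x else \<zero>\<^bsub>T\<^esub>),
     dmap B m i j z)"
proof -
  interpret T: module R T using B T by (simp add: piece_module)
  have dy: "dmap B m i' j' y \<in> carrier T"
    unfolding T using y by (intro module_hom_closed[OF dmap_hom[OF B]]) (auto simp: i' j')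
  have "path_diff r B m i j (x, y, z) =
    (dmap B m i j x,
     if m = r then (\<ominus>\<^bsub>T\<^esub> x) \<ominus>\<^bsub>T\<^esub> dmap B m i' j' y \<oplus>\<^bsub>T\<^esub> z
     else [((-1::int) ^ (m + r + 1))] \<cdot>\<^bsub>T\<^esub> dmap B m i' j' y,
     dmap B m i j z)"
    unfolding i' j' T path_diff_def Let_def using x y[unfolded i' j'] z
    by (simp add: path_comp_def direct_sum_simps)
  moreover have "(\<ominus>\<^bsub>T\<^esub> x) \<ominus>\<^bsub>T\<^esub> dmap B m i' j' y \<oplus>\<^bsub>T\<^esub> z =
      [((-1::int) ^ (m + r + 1))] \<cdot>\<^bsub>T\<^esub> dmap B m i' j' y \<oplus>\<^bsub>T\<^esub> (z \<ominus>\<^bsub>T\<^esub> x)" if "m = r"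
  proof -
    have "x \<in> carrier T" "z \<in> carrier T" using x z T that by auto
    moreover have "(-1::int) ^ (m + r + 1) = -1" using that by simp
    ultimately show ?thesis
      using dy by (simp only: T.M.int_smult_minus_one) (simp add: a_minus_def T.M.a_ac)
  qed
  ultimately show ?thesis using dy by simp
qed

lemma path_diff_bigraded:
  assumes B: "twisted_complex R B"
  shows "path_diff r B m \<in> bigraded_maps R (path_comp r B) (path_comp r B) (- int m) (- int m + 1)"
  unfolding bigraded_maps_def
proof (safe)
  fix i j
  define T where "T = piece B (i - int m + int r) (j - int m + int r)"
  define M where "M = piece B i j"
  define N where "N = piece B (i + int r) (j + int r - 1)"
  define P where "P = piece B (i - int m) (j - int m + 1)"
  interpret T: module R T using B T_def by (simp add: piece_module)
  interpret M: module R M using B M_def by (simp add: piece_module)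
  interpret N: module R N using B N_def by (simp add: piece_module)
  \<comment> \<open>The outer entries are values of a homomorphism already, so only the middle entry
    has to be checked for closure, additivity and linearity.\<close>
  define \<mu> where "\<mu> = (\<lambda>x y z. [((-1::int) ^ (m + r + 1))] \<cdot>\<^bsub>T\<^esub> dmap B m (i + int r) (j + int r - 1) y
      \<oplus>\<^bsub>T\<^esub> (if m = r then z \<ominus>\<^bsub>T\<^esub> x else \<zero>\<^bsub>T\<^esub>))"
  have app: "path_diff r B m i j (x, y, z) = (dmap B m i j x, \<mu> x y z, dmap B m i j z)"
    if "x \<in> carrier M" "y \<in> carrier N" "z \<in> carrier M" for x y z
    unfolding \<mu>_def using that by (intro path_diff_apply[OF B]) (auto simp: M_def N_def T_def)
  have d: "dmap B m i j \<in> module_hom R M P"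
    unfolding M_def P_def by (intro dmap_hom[OF B]) auto
  have dN: "dmap B m (i + int r) (j + int r - 1) \<in> module_hom R N T"
    unfolding N_def T_def by (intro dmap_hom[OF B]) auto
  have MT: "M = T" if "m = r" using that by (simp add: M_def T_def)
  have cl: "\<mu> x y z \<in> carrier T"
    if "x \<in> carrier M" "y \<in> carrier N" "z \<in> carrier M" for x y z
    using that MT dN by (auto simp: \<mu>_def module_hom_closed)
  have add: "\<mu> (x \<oplus>\<^bsub>M\<^esub> x') (y \<oplus>\<^bsub>N\<^esub> y') (z \<oplus>\<^bsub>M\<^esub> z') = \<mu> x y z \<oplus>\<^bsub>T\<^esub> \<mu> x' y' z'"
    if "x \<in> carrier M" "y \<in> carrier N" "z \<in> carrier M" "x' \<in> carrier M" "y' \<in> carrier N" "z' \<in> carrier M"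
    for x y z x' y' z'
    using that MT module_hom_closed[OF dN]
    by (auto simp: \<mu>_def module_hom_add[OF dN] T.M.add.int_pow_distrib a_minus_def T.M.minus_add T.M.a_ac
        simp del: power_Suc)
  have smult: "\<mu> (a \<odot>\<^bsub>M\<^esub> x) (a \<odot>\<^bsub>N\<^esub> y) (a \<odot>\<^bsub>M\<^esub> z) = a \<odot>\<^bsub>T\<^esub> \<mu> x y z"
    if "a \<in> carrier R" "x \<in> carrier M" "y \<in> carrier N" "z \<in> carrier M" for a x y z
  proof -
    \<comment> \<open>Scalars commute with the sign because multiplication by \<open>a\<close> is
      additive.\<close>
    have "a \<odot>\<^bsub>T\<^esub> ([n] \<cdot>\<^bsub>T\<^esub> w) = [n] \<cdot>\<^bsub>T\<^esub> (a \<odot>\<^bsub>T\<^esub> w)" if "w \<in> carrier T" for w and n :: int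
      using that \<open>a \<in> carrier R\<close>
      by (intro abelian_group_int_smult_hom) (auto simp: T.smult_r_distr T.M.abelian_group_axioms)
    then show ?thesis
      using that MT module_hom_closed[OF dN]
      by (auto simp: \<mu>_def module_hom_smult[OF dN] a_minus_def T.smult_r_distr T.smult_r_minus
          simp del: power_Suc)
  qed
  have dom: "path_comp r B i j = M \<oplus>\<oplus> N \<oplus>\<oplus> M"
    by (simp add: path_comp_def M_def N_def)
  have cod: "path_comp r B (i + - int m) (j + (- int m + 1)) = P \<oplus>\<oplus> T \<oplus>\<oplus> P"
    by (simp add: path_comp_def P_def T_def algebra_simps)
  have ext: "path_diff r B m i j \<in> extensional (carrier (M \<oplus>\<oplus> N \<oplus>\<oplus> M))"
    unfolding path_diff_def dom[symmetric] by (rule restrict_extensional)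
  show "path_diff r B m i j \<in> module_hom R (path_comp r B i j)
          (path_comp r B (i + - int m) (j + (- int m + 1)))"
    unfolding dom cod using ext
    by (auto simp: module_hom_def PiE_def direct_sum_simps app cl add smult
        module_hom_closed[OF d] module_hom_add[OF d] module_hom_smult[OF d])
qed

text \<open>\<open>twisted_morphism\<close> demands that its target be a twisted complex, so this is
  required before a family \<open>h'\<close> can yield an r-homotopy. The outer entries reduce to
  the square-zero equation of \<open>B\<close> at \<open>x\<close> and \<open>z\<close>, the middle
  one to \<open>path_square_sum\<close>.\<close>

lemma path_complex_twisted:
  assumes B: "twisted_complex R B"
  shows "twisted_complex R (path_complex r B)"
  unfolding twisted_complex_def path_complex_def bigraded_module_def tw_data.simps Let_def
proof (safe)
  show "module R (path_comp r B i j)" for i j by (rule path_comp_module[OF B])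
  show "path_diff r B m \<in> bigraded_maps R (path_comp r B) (path_comp r B) (- int m) (- int m + 1)" for m
    by (rule path_diff_bigraded[OF B])
next
  fix m i j x y z
  define M where "M = piece B i j"
  define N where "N = piece B (i + int r) (j + int r - 1)"
  define S where "S = piece B (i - int m) (j - int m + 2)"
  define T where "T = piece B (i - int m + int r) (j - int m + 2 + int r - 1)"
  interpret S: module R S using B S_def by (simp add: piece_module)
  interpret T: module R T using B T_def by (simp add: piece_module)
  assume "(x, y, z) \<in> carrier (path_comp r B i j)"
  then have x: "x \<in> carrier M" and y: "y \<in> carrier N" and z: "z \<in> carrier M"
    by (auto simp: path_comp_def M_def N_def direct_sum_simps)
  have cod: "path_comp r B (i - int m) (j - int m + 2) = S \<oplus>\<oplus> T \<oplus>\<oplus> S"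
    by (simp add: path_comp_def S_def T_def)
  define dd where "dd = (\<lambda>x k. dmap B k (i - int (m - k)) (j - int (m - k) + 1) (dmap B (m - k) i j x))"
  define u where "u = (\<lambda>k. dmap B k (i - int (m - k) + int r) (j - int (m - k) + int r)
      (dmap B (m - k) (i + int r) (j + int r - 1) y))"
  \<comment> \<open>Both difference terms give this element: at m - k = r the outer d_k = d_{m-r} is
    applied to z - x, and at k = r the outer differential subtracts the entries d_{m-r} x and
    d_{m-r} z. It is shown to lie in \<open>T\<close> only for \<open>r \<le> m\<close>, and it
    occurs only then.\<close>
  define e where "e = dmap B (m - r) i j z \<ominus>\<^bsub>T\<^esub> dmap B (m - r) i j x"
  have dd: "dd w k \<in> carrier S" if "w \<in> carrier M" "k \<le> m" for w k
    unfolding dd_def S_def using that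
    by (intro module_hom_closed[OF dmap_hom[OF B]]) (auto simp: M_def of_nat_diff)
  have u: "u k \<in> carrier T" if "k \<le> m" for k
    unfolding u_def T_def using that y
    by (intro module_hom_closed[OF dmap_hom[OF B]]) (auto simp: N_def of_nat_diff)
  have de: "dmap B (m - r) i j w \<in> carrier T" if "w \<in> carrier M" "r \<le> m" for w
    unfolding T_def using that
    by (intro module_hom_closed[OF dmap_hom[OF B]]) (auto simp: M_def of_nat_diff)
  have e: "e \<in> carrier T" if "r \<le> m"
    using that x z de by (simp add: e_def)
  let ?\<sigma> = "\<lambda>k. [((-1::int) ^ (k + r + 1))] \<cdot>\<^bsub>T\<^esub>
       ([((-1::int) ^ (m - k + r + 1))] \<cdot>\<^bsub>T\<^esub> u k \<oplus>\<^bsub>T\<^esub> (if m - k = r then e else \<zero>\<^bsub>T\<^esub>))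
         \<oplus>\<^bsub>T\<^esub> (if k = r then e else \<zero>\<^bsub>T\<^esub>)"
  have \<sigma>: "?\<sigma> k \<in> carrier T" if "k \<le> m" for k
    using that u e by auto
  have summand: "path_diff r B k (i - int (m - k)) (j - int (m - k) + 1) (path_diff r B (m - k) i j (x, y, z))
      = (dd x k, ?\<sigma> k, dd z k)" if k: "k \<le> m" for k
  proof -
    \<comment> \<open>\<open>T1\<close> is the middle component reached after the inner
      differential; \<open>\<mu>\<close> below is the middle entry there, and
      \<open>\<delta>\<close> is the d_k that carries it on to \<open>T\<close>.\<close>
    define T1 where "T1 = piece B (i - int (m - k) + int r) (j - int (m - k) + int r)"
    interpret T1: module R T1 using B T1_def by (simp add: piece_module)
    define dy where "dy = dmap B (m - k) (i + int r) (j + int r - 1) y"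
    define \<mu> where "\<mu> = [((-1::int) ^ (m - k + r + 1))] \<cdot>\<^bsub>T1\<^esub> dy
         \<oplus>\<^bsub>T1\<^esub> (if m - k = r then z \<ominus>\<^bsub>T1\<^esub> x else \<zero>\<^bsub>T1\<^esub>)"
    have inner: "path_diff r B (m - k) i j (x, y, z) = (dmap B (m - k) i j x, \<mu>, dmap B (m - k) i j z)"
      unfolding \<mu>_def dy_def using x y z
      by (intro path_diff_apply[OF B]) (auto simp: M_def N_def T1_def)
    have d: "dmap B (m - k) i j w \<in> carrier (piece B (i - int (m - k)) (j - int (m - k) + 1))"
      if "w \<in> carrier M" for w
      using that by (intro module_hom_closed[OF dmap_hom[OF B]]) (auto simp: M_def)
    have dy: "dy \<in> carrier T1"
      unfolding dy_def T1_def using y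
      by (intro module_hom_closed[OF dmap_hom[OF B]]) (auto simp: N_def)
    have xz: "z \<in> carrier T1" "x \<in> carrier T1" if "m - k = r"
      using x z by (simp_all add: M_def T1_def flip: that)
    then have xz': "(if m - k = r then z \<ominus>\<^bsub>T1\<^esub> x else \<zero>\<^bsub>T1\<^esub>) \<in> carrier T1" by auto
    have \<mu>: "\<mu> \<in> carrier T1"
      using dy xz' by (simp add: \<mu>_def del: power_Suc)
    define \<delta> where "\<delta> = dmap B k (i - int (m - k) + int r) (j - int (m - k) + int r)"
    have hom: "\<delta> \<in> module_hom R T1 T"
      unfolding \<delta>_def T1_def T_def using k by (intro dmap_hom[OF B]) (auto simp: of_nat_diff)
    have "\<delta> (z \<ominus>\<^bsub>T1\<^esub> x) = e" if "m - k = r"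
    proof -
      have "k = m - r" "r \<le> m" using that k by auto
      then have "\<delta> = dmap B (m - r) i j" by (simp add: \<delta>_def)
      then show ?thesis
        using xz[OF that] module_hom_diff[OF T1.module_axioms T.module_axioms hom]
        by (simp add: e_def)
    qed
    then have "\<delta> (if m - k = r then z \<ominus>\<^bsub>T1\<^esub> x else \<zero>\<^bsub>T1\<^esub>) = (if m - k = r then e else \<zero>\<^bsub>T\<^esub>)"
      using module_hom_zero[OF T1.module_axioms T.module_axioms hom] by simp
    moreover have uk: "u k = \<delta> dy" by (simp add: u_def \<delta>_def dy_def)
    ultimately have \<delta>\<mu>: "\<delta> \<mu> = [((-1::int) ^ (m - k + r + 1))] \<cdot>\<^bsub>T\<^esub> u k \<oplus>\<^bsub>T\<^esub> (if m - k = r then e else \<zero>\<^bsub>T\<^esub>)"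
      using dy xz' module_hom_int_smult[OF T1.module_axioms T.module_axioms hom dy]
      by (simp add: \<mu>_def module_hom_add[OF hom] uk del: power_Suc)
    have "path_diff r B k (i - int (m - k)) (j - int (m - k) + 1)
        (dmap B (m - k) i j x, \<mu>, dmap B (m - k) i j z) =
      (dd x k, [((-1::int) ^ (k + r + 1))] \<cdot>\<^bsub>T\<^esub> \<delta> \<mu> \<oplus>\<^bsub>T\<^esub>
          (if k = r then dmap B (m - k) i j z \<ominus>\<^bsub>T\<^esub> dmap B (m - k) i j x else \<zero>\<^bsub>T\<^esub>), dd z k)"
      unfolding \<delta>_def dd_def using d x z \<mu> k
      by (intro path_diff_apply[OF B]) (auto simp: T1_def T_def of_nat_diff algebra_simps)
    also have "\<dots> = (dd x k, ?\<sigma> k, dd z k)"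
      by (simp add: \<delta>\<mu> e_def del: power_Suc)
    finally show ?thesis unfolding inner .
  qed
  have SM: "module R S" "module R T" "module R (S \<oplus>\<oplus> T \<oplus>\<oplus> S)"
    by (simp_all add: module_direct_sum S.module_axioms T.module_axioms)
  interpret STS: module R "S \<oplus>\<oplus> T \<oplus>\<oplus> S" by (rule SM(3))
  have "(\<Oplus>\<^bsub>S \<oplus>\<oplus> T \<oplus>\<oplus> S\<^esub> k\<in>{..m}. [((-1::int) ^ k)] \<cdot>\<^bsub>S \<oplus>\<oplus> T \<oplus>\<oplus> S\<^esub>
      path_diff r B k (i - int (m - k)) (j - int (m - k) + 1) (path_diff r B (m - k) i j (x, y, z))) =
    (\<Oplus>\<^bsub>S \<oplus>\<oplus> T \<oplus>\<oplus> S\<^esub> k\<in>{..m}. ([((-1::int) ^ k)] \<cdot>\<^bsub>S\<^esub> dd x k, [((-1::int) ^ k)] \<cdot>\<^bsub>T\<^esub> ?\<sigma> k,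
       [((-1::int) ^ k)] \<cdot>\<^bsub>S\<^esub> dd z k))"
  proof (rule STS.M.finsum_cong')
    show "(\<lambda>k. ([((-1::int) ^ k)] \<cdot>\<^bsub>S\<^esub> dd x k, [((-1::int) ^ k)] \<cdot>\<^bsub>T\<^esub> ?\<sigma> k,
       [((-1::int) ^ k)] \<cdot>\<^bsub>S\<^esub> dd z k)) \<in> {..m} \<rightarrow> carrier (S \<oplus>\<oplus> T \<oplus>\<oplus> S)"
      using \<sigma> dd x z by (simp add: direct_sum_simps del: power_Suc)
  next
    fix k assume "k \<in> {..m}"
    then have k: "k \<le> m" by simp
    show "[((-1::int) ^ k)] \<cdot>\<^bsub>S \<oplus>\<oplus> T \<oplus>\<oplus> S\<^esub>
      path_diff r B k (i - int (m - k)) (j - int (m - k) + 1) (path_diff r B (m - k) i j (x, y, z)) =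
      ([((-1::int) ^ k)] \<cdot>\<^bsub>S\<^esub> dd x k, [((-1::int) ^ k)] \<cdot>\<^bsub>T\<^esub> ?\<sigma> k, [((-1::int) ^ k)] \<cdot>\<^bsub>S\<^esub> dd z k)"
      unfolding summand[OF k] using dd[OF x k] dd[OF z k] \<sigma>[OF k]
      by (intro int_smult_triple[OF SM(1,2)])
  qed simp
  also have "\<dots> = (\<Oplus>\<^bsub>S\<^esub> k\<in>{..m}. [((-1::int) ^ k)] \<cdot>\<^bsub>S\<^esub> dd x k, \<Oplus>\<^bsub>T\<^esub> k\<in>{..m}. [((-1::int) ^ k)] \<cdot>\<^bsub>T\<^esub> ?\<sigma> k,
       \<Oplus>\<^bsub>S\<^esub> k\<in>{..m}. [((-1::int) ^ k)] \<cdot>\<^bsub>S\<^esub> dd z k)"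
    using \<sigma> dd x z
    by (intro finsum_triple[OF SM(1,2)]) (auto simp del: power_Suc)
  also have "\<dots> = (\<zero>\<^bsub>S\<^esub>, \<zero>\<^bsub>T\<^esub>, \<zero>\<^bsub>S\<^esub>)"
  proof -
    have "(\<Oplus>\<^bsub>S\<^esub> k\<in>{..m}. [((-1::int) ^ k)] \<cdot>\<^bsub>S\<^esub> dd w k) = \<zero>\<^bsub>S\<^esub>" if "w \<in> carrier M" for w
      unfolding dd_def using that by (intro dmap_square[OF B]) (auto simp: M_def S_def)
    moreover have "(\<Oplus>\<^bsub>T\<^esub> k\<in>{..m}. [((-1::int) ^ k)] \<cdot>\<^bsub>T\<^esub> u k) = \<zero>\<^bsub>T\<^esub>"
      unfolding u_def using y by (intro dmap_square[OF B]) (auto simp: N_def T_def algebra_simps)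
    then have "(\<Oplus>\<^bsub>T\<^esub> k\<in>{..m}. [((-1::int) ^ k)] \<cdot>\<^bsub>T\<^esub> ?\<sigma> k) = \<zero>\<^bsub>T\<^esub>"
      using u e by (intro T.M.path_square_sum) auto
    ultimately show ?thesis using x z by simp
  qed
  finally show "(\<Oplus>\<^bsub>path_comp r B (i - int m) (j - int m + 2)\<^esub> k\<in>{..m}.
      [((-1::int) ^ k)] \<cdot>\<^bsub>path_comp r B (i - int m) (j - int m + 2)\<^esub>
      path_diff r B k (i - int (m - k)) (j - int (m - k) + 1) (path_diff r B (m - k) i j (x, y, z))) =
     \<zero>\<^bsub>path_comp r B (i - int m) (j - int m + 2)\<^esub>"
    by (simp add: cod direct_sum_simps)
qed

section \<open>Morphisms into the path complex\<close>

text \<open>This is the candidate inverse of \<open>middle_component\<close>. It is restricted to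
  the carrier so that it can be extensional, and hence equal to a given homotopy as a
  function.\<close>

definition path_family ::
  "('r, 'a) tw_data \<Rightarrow> (nat \<Rightarrow> ('a, 'b) bimap) \<Rightarrow> (nat \<Rightarrow> ('a, 'b) bimap) \<Rightarrow> (nat \<Rightarrow> ('a, 'b) bimap)
     \<Rightarrow> nat \<Rightarrow> ('a, 'b \<times> 'b \<times> 'b) bimap"
  where "path_family A f h' g m i j = (\<lambda>x\<in>carrier (piece A i j). (f m i j x, h' m i j x, g m i j x))"

lemma bigraded_map_restrict:
  "\<phi> \<in> bigraded_maps R A B p q \<Longrightarrow> restrict (\<phi> i j) (carrier (A i j)) = \<phi> i j"
  by (auto simp: bigraded_maps_def module_hom_def PiE_def extensional_restrict)

text \<open>\<open>path_family\<close> sees \<open>h'\<close> only on carriers. Extensionality of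
  \<open>h'\<close> is therefore assumed, so that the bidegree condition can be read back from the
  triple.\<close>

lemma path_family_bigraded_iff:
  assumes A: "twisted_complex R A"
    and f: "f m \<in> bigraded_maps R (piece A) (piece B) (- int m) (- int m)"
    and g: "g m \<in> bigraded_maps R (piece A) (piece B) (- int m) (- int m)"
    and h': "\<And>i j. restrict (h' m i j) (carrier (piece A i j)) = h' m i j"
  shows "path_family A f h' g m \<in> bigraded_maps R (piece A) (path_comp r B) (- int m) (- int m) \<longleftrightarrow>
    h' m \<in> bigraded_maps R (piece A) (piece B) (- int m + int r) (- int m + int r - 1)"
proof -
  have "path_family A f h' g m i j \<in> module_hom R (piece A i j) (path_comp r B (i + - int m) (j + - int m))
      \<longleftrightarrow> h' m i j \<in> module_hom R (piece A i j) (piece B (i + (- int m + int r)) (j + (- int m + int r - 1)))"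
    for i j
  proof -
    have "path_comp r B (i + - int m) (j + - int m) = piece B (i + - int m) (j + - int m) \<oplus>\<oplus>
        piece B (i + (- int m + int r)) (j + (- int m + int r - 1)) \<oplus>\<oplus> piece B (i + - int m) (j + - int m)"
      by (rule path_comp_eq) auto
    then show ?thesis
      using f g
      by (simp add: path_family_def restrict_pair_module_hom_iff[OF piece_module[OF A]]
          bigraded_map_restrict[OF f] bigraded_map_restrict[OF g] h') (simp add: bigraded_maps_def)
  qed
  then show ?thesis by (simp add: bigraded_maps_def)
qed

text \<open>In the composition sum every term with k > 0 is the zero of the common target component,
  so the term k = 0 alone remains.\<close>

lemma twisted_compose_strict_family:
  assumes B: "twisted_complex R B"
    and h: "\<And>m. h m \<in> bigraded_maps R (piece A) (piece P) (- int m) (- int m)"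
    and \<phi>: "\<And>i j x. x \<in> carrier (piece P i j) \<Longrightarrow> \<phi> x \<in> carrier (piece B i j)"
  shows "twisted_compose A B (strict_family P B \<phi>) h m i j = (\<lambda>x\<in>carrier (piece A i j). \<phi> (h m i j x))"
  unfolding twisted_compose_def
proof (rule restrict_ext)
  fix x assume x: "x \<in> carrier (piece A i j)"
  define T where "T = piece B (i - int m) (j - int m)"
  interpret T: module R T using B T_def by (simp add: piece_module)
  have hx: "h l i j x \<in> carrier (piece P (i - int l) (j - int l))" for l
    using x by (intro module_hom_closed[OF bigraded_map_hom[OF h]]) auto
  have "\<phi> (h m i j x) \<in> carrier T"
    unfolding T_def by (intro \<phi> hx)
  moreover have "strict_family P B \<phi> k (i - int (m - k)) (j - int (m - k)) (h (m - k) i j x) =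
      (if k = 0 then \<phi> (h m i j x) else \<zero>\<^bsub>T\<^esub>)" if "k \<le> m" for k
    using hx[of "m - k"] that by (auto simp: strict_family_def T_def of_nat_diff)
  ultimately have "(\<Oplus>\<^bsub>T\<^esub> k\<in>{..m}. strict_family P B \<phi> k (i - int (m - k)) (j - int (m - k)) (h (m - k) i j x)) =
      (\<Oplus>\<^bsub>T\<^esub> k\<in>{..m}. if k = 0 then \<phi> (h m i j x) else \<zero>\<^bsub>T\<^esub>)"
    by (intro T.M.finsum_cong') auto
  also have "\<dots> = \<phi> (h m i j x)"
    using \<open>\<phi> (h m i j x) \<in> carrier T\<close> by (subst T.M.finsum_at) auto
  finally show "(\<Oplus>\<^bsub>piece B (i - int m) (j - int m)\<^esub> k\<in>{..m}.
      strict_family P B \<phi> k (i - int (m - k)) (j - int (m - k)) (h (m - k) i j x)) = \<phi> (h m i j x)"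
    unfolding T_def .
qed

lemma twisted_compose_path_ends:
  assumes B: "twisted_complex R B"
    and h: "\<And>m. h m \<in> bigraded_maps R (piece A) (path_comp r B) (- int m) (- int m)"
  shows "twisted_compose A B (path_minus r B) h m i j = (\<lambda>x\<in>carrier (piece A i j). fst (h m i j x))"
    and "twisted_compose A B (path_plus r B) h m i j = (\<lambda>x\<in>carrier (piece A i j). snd (snd (h m i j x)))"
proof -
  have h': "\<And>m. h m \<in> bigraded_maps R (piece A) (piece (path_complex r B)) (- int m) (- int m)"
    using h by (simp add: path_complex_def)
  show "twisted_compose A B (path_minus r B) h m i j = (\<lambda>x\<in>carrier (piece A i j). fst (h m i j x))"
    unfolding path_minus_def
    by (subst twisted_compose_strict_family[OF B h'])
      (auto simp: path_complex_def path_comp_def direct_sum_simps fun_eq_iff case_prod_beta)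
  show "twisted_compose A B (path_plus r B) h m i j = (\<lambda>x\<in>carrier (piece A i j). snd (snd (h m i j x)))"
    unfolding path_plus_def
    by (subst twisted_compose_strict_family[OF B h'])
      (auto simp: path_complex_def path_comp_def direct_sum_simps fun_eq_iff case_prod_beta)
qed

lemma twisted_morphism_map:
  "twisted_morphism R A B f \<Longrightarrow> f m \<in> bigraded_maps R (piece A) (piece B) (- int m) (- int m)"
  by (simp add: twisted_morphism_def)

text \<open>Both sides are sums of triples and split into three sums. The outer equalities hold
  since \<open>f\<close> and \<open>g\<close> are morphisms, so everything is decided in the middle
  entry, where \<open>middle_equation_iff\<close> rearranges the terms.\<close>

lemma path_family_equation_iff:
  fixes A :: "('r, 'a) tw_data" and B :: "('r, 'b) tw_data" and h' :: "nat \<Rightarrow> ('a, 'b) bimap"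
  assumes f: "twisted_morphism R A B f" and g: "twisted_morphism R A B g"
    and h': "\<And>m. h' m \<in> bigraded_maps R (piece A) (piece B) (- int m + int r) (- int m + int r - 1)"
    and x: "x \<in> carrier (piece A i j)"
    and S: "S = path_comp r B (i - int m) (j - int m + 1)"
    and T: "T = piece B (i - int m + int r) (j - int m + int r)"
  shows "(\<Oplus>\<^bsub>S\<^esub> k\<in>{..m}. path_diff r B k (i - int (m - k)) (j - int (m - k)) (path_family A f h' g (m - k) i j x)) =
      (\<Oplus>\<^bsub>S\<^esub> k\<in>{..m}. [((-1::int) ^ k)] \<cdot>\<^bsub>S\<^esub>
         path_family A f h' g k (i - int (m - k)) (j - int (m - k) + 1) (dmap A (m - k) i j x)) \<longleftrightarrow>
    (\<Oplus>\<^bsub>T\<^esub> k\<in>{..m}.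
        [((-1::int) ^ (k + r))] \<cdot>\<^bsub>T\<^esub>
           (dmap B k (i - int (m - k) + int r) (j - int (m - k) + int r - 1) (h' (m - k) i j x))
        \<oplus>\<^bsub>T\<^esub> [((-1::int) ^ k)] \<cdot>\<^bsub>T\<^esub>
           (h' k (i - int (m - k)) (j - int (m - k) + 1) (dmap A (m - k) i j x))) =
      (if m < r then \<zero>\<^bsub>T\<^esub> else g (m - r) i j x \<ominus>\<^bsub>T\<^esub> f (m - r) i j x)"
    (is "?L = ?R \<longleftrightarrow> ?E")
proof -
  have A: "twisted_complex R A" and B: "twisted_complex R B"
    using f by (auto simp: twisted_morphism_def)
  define U where "U = piece B (i - int m) (j - int m + 1)"
  interpret U: module R U using B U_def by (simp add: piece_module)
  interpret T: module R T using B T by (simp add: piece_module)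
  have S': "S = U \<oplus>\<oplus> T \<oplus>\<oplus> U"
    unfolding S U_def T by (rule path_comp_eq) auto
  interpret S: module R S unfolding S by (rule path_comp_module[OF B])
  \<comment> \<open>\<open>db\<close> and \<open>da\<close> are the summands of the two sides of a
    morphism equation, with the family as argument: \<open>db\<close> serves \<open>f\<close> and
    \<open>g\<close>, while \<open>da\<close> serves \<open>h'\<close> as well. The differential of
    \<open>h'\<close> starts in shifted degrees and gets its own name \<open>u\<close>.\<close>
  define db where "db = (\<lambda>(f :: nat \<Rightarrow> ('a, 'b) bimap) k.
      dmap B k (i - int (m - k)) (j - int (m - k)) (f (m - k) i j x))"
  define da where "da = (\<lambda>(f :: nat \<Rightarrow> ('a, 'b) bimap) k.
      f k (i - int (m - k)) (j - int (m - k) + 1) (dmap A (m - k) i j x))"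
  define u where "u = (\<lambda>k. dmap B k (i - int (m - k) + int r) (j - int (m - k) + int r - 1) (h' (m - k) i j x))"
  have dx: "dmap A l i j x \<in> carrier (piece A (i - int l) (j - int l + 1))" for l
    using x by (intro module_hom_closed[OF dmap_hom[OF A]]) auto
  have fx: "\<phi> l i j x \<in> carrier (piece B (i - int l) (j - int l))" if "twisted_morphism R A B \<phi>" for \<phi> l
    using x by (intro module_hom_closed[OF bigraded_map_hom[OF twisted_morphism_map[OF that]]]) auto
  have hx: "h' l i j x \<in> carrier (piece B (i - int l + int r) (j - int l + int r - 1))" for l
    using x by (intro module_hom_closed[OF bigraded_map_hom[OF h']]) auto
  have db: "db \<phi> k \<in> carrier U" if "twisted_morphism R A B \<phi>" "k \<le> m" for \<phi> k
    unfolding db_def U_def using fx[OF that(1), of "m - k"] that(2)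
    by (intro module_hom_closed[OF dmap_hom[OF B]]) (auto simp: of_nat_diff)
  have da: "da \<phi> k \<in> carrier U" if "twisted_morphism R A B \<phi>" "k \<le> m" for \<phi> k
    unfolding da_def U_def using dx[of "m - k"] that(2)
    by (intro module_hom_closed[OF bigraded_map_hom[OF twisted_morphism_map[OF that(1)]]])
      (auto simp: of_nat_diff)
  have dah: "da h' k \<in> carrier T" if "k \<le> m" for k
    unfolding da_def T using dx[of "m - k"] that
    by (intro module_hom_closed[OF bigraded_map_hom[OF h']]) (auto simp: of_nat_diff)
  have u: "u k \<in> carrier T" if "k \<le> m" for k
    unfolding u_def T using hx[of "m - k"] that
    by (intro module_hom_closed[OF dmap_hom[OF B]]) (auto simp: of_nat_diff)
  \<comment> \<open>This is the value of z - x at k = r, where m - k becomes m - r. For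
    \<open>r \<le> m\<close> the degrees i - (m - r) and j - (m - r) are those of
    \<open>T\<close>.\<close>
  define w where "w = g (m - r) i j x \<ominus>\<^bsub>T\<^esub> f (m - r) i j x"
  have w: "w \<in> carrier T" if "r \<le> m"
  proof -
    have "piece B (i - int (m - r)) (j - int (m - r)) = T"
      unfolding T using that by (intro arg_cong2[where f = "piece B"]) auto
    then show ?thesis
      using fx[OF f, of "m - r"] fx[OF g, of "m - r"] by (simp add: w_def)
  qed
  let ?\<sigma> = "\<lambda>k. [((-1::int) ^ (k + r + 1))] \<cdot>\<^bsub>T\<^esub> u k \<oplus>\<^bsub>T\<^esub> (if k = r then w else \<zero>\<^bsub>T\<^esub>)"
  let ?\<tau> = "\<lambda>\<phi> k. [((-1::int) ^ k)] \<cdot>\<^bsub>T\<^esub> da \<phi> k"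
  let ?\<upsilon> = "\<lambda>\<phi> k. [((-1::int) ^ k)] \<cdot>\<^bsub>U\<^esub> da \<phi> k"
  have \<sigma>: "?\<sigma> k \<in> carrier T" if "k \<le> m" for k
    using u[OF that] w that by auto
  have l: "path_diff r B k (i - int (m - k)) (j - int (m - k)) (path_family A f h' g (m - k) i j x) =
      (db f k, ?\<sigma> k, db g k)" if k: "k \<le> m" for k
  proof -
    have "path_diff r B k (i - int (m - k)) (j - int (m - k)) (path_family A f h' g (m - k) i j x) =
      (db f k, [((-1::int) ^ (k + r + 1))] \<cdot>\<^bsub>T\<^esub> u k \<oplus>\<^bsub>T\<^esub>
        (if k = r then g (m - k) i j x \<ominus>\<^bsub>T\<^esub> f (m - k) i j x else \<zero>\<^bsub>T\<^esub>), db g k)"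
      unfolding db_def u_def path_family_def restrict_apply'[OF x]
      by (rule path_diff_apply[OF B fx[OF f] fx[OF g] hx]) (use k in \<open>auto simp: T of_nat_diff\<close>)
    then show ?thesis by (simp add: w_def)
  qed
  have L: "?L = (\<Oplus>\<^bsub>S\<^esub> k\<in>{..m}. (db f k, ?\<sigma> k, db g k))"
  proof (rule S.M.finsum_cong')
    show "(\<lambda>k. (db f k, ?\<sigma> k, db g k)) \<in> {..m} \<rightarrow> carrier S"
      using db[OF f] db[OF g] \<sigma> by (simp add: S' direct_sum_simps del: power_Suc)
  qed (rule refl, rule l, simp)
  also have "\<dots> = (\<Oplus>\<^bsub>U\<^esub> k\<in>{..m}. db f k, \<Oplus>\<^bsub>T\<^esub> k\<in>{..m}. ?\<sigma> k, \<Oplus>\<^bsub>U\<^esub> k\<in>{..m}. db g k)"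
    unfolding S' using db[OF f] db[OF g] \<sigma>
    by (intro finsum_triple[OF U.module_axioms T.module_axioms]) (auto simp del: power_Suc)
  finally have L: "?L = (\<Oplus>\<^bsub>U\<^esub> k\<in>{..m}. db f k, \<Oplus>\<^bsub>T\<^esub> k\<in>{..m}. ?\<sigma> k, \<Oplus>\<^bsub>U\<^esub> k\<in>{..m}. db g k)" .
  have r: "[((-1::int) ^ k)] \<cdot>\<^bsub>S\<^esub>
         path_family A f h' g k (i - int (m - k)) (j - int (m - k) + 1) (dmap A (m - k) i j x) =
      (?\<upsilon> f k, ?\<tau> h' k, ?\<upsilon> g k)" if k: "k \<le> m" for k
  proof -
    have "path_family A f h' g k (i - int (m - k)) (j - int (m - k) + 1) (dmap A (m - k) i j x) =
        (da f k, da h' k, da g k)"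
      unfolding path_family_def restrict_apply'[OF dx] da_def ..
    then show ?thesis
      unfolding S' using int_smult_triple[OF U.module_axioms T.module_axioms da[OF f k] dah[OF k] da[OF g k]]
      by (simp only:)
  qed
  have "?R = (\<Oplus>\<^bsub>S\<^esub> k\<in>{..m}. (?\<upsilon> f k, ?\<tau> h' k, ?\<upsilon> g k))"
  proof (rule S.M.finsum_cong')
    show "(\<lambda>k. (?\<upsilon> f k, ?\<tau> h' k, ?\<upsilon> g k)) \<in> {..m} \<rightarrow> carrier S"
      using da[OF f] da[OF g] dah by (simp add: S' direct_sum_simps)
  qed (rule refl, rule r, simp)
  also have "\<dots> = (\<Oplus>\<^bsub>U\<^esub> k\<in>{..m}. ?\<upsilon> f k, \<Oplus>\<^bsub>T\<^esub> k\<in>{..m}. ?\<tau> h' k, \<Oplus>\<^bsub>U\<^esub> k\<in>{..m}. ?\<upsilon> g k)"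
    unfolding S' using da[OF f] da[OF g] dah
    by (intro finsum_triple[OF U.module_axioms T.module_axioms]) auto
  finally have R: "?R = (\<Oplus>\<^bsub>U\<^esub> k\<in>{..m}. ?\<upsilon> f k, \<Oplus>\<^bsub>T\<^esub> k\<in>{..m}. ?\<tau> h' k, \<Oplus>\<^bsub>U\<^esub> k\<in>{..m}. ?\<upsilon> g k)" .
  have ends: "(\<Oplus>\<^bsub>U\<^esub> k\<in>{..m}. db \<phi> k) = (\<Oplus>\<^bsub>U\<^esub> k\<in>{..m}. ?\<upsilon> \<phi> k)"
    if "twisted_morphism R A B \<phi>" for \<phi>
    using that x unfolding twisted_morphism_def Let_def U_def db_def da_def by blast
  have "?L = ?R \<longleftrightarrow> (\<Oplus>\<^bsub>T\<^esub> k\<in>{..m}. ?\<sigma> k) = (\<Oplus>\<^bsub>T\<^esub> k\<in>{..m}. ?\<tau> h' k)"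
    unfolding L R ends[OF f] ends[OF g] by blast
  also have "\<dots> \<longleftrightarrow> ?E"
    unfolding u_def[symmetric] w_def[symmetric] da_def[symmetric]
    using u dah w
    by (subst T.M.middle_equation_iff) (auto simp: u_def da_def w_def)
  finally show ?thesis .
qed

section \<open>The correspondence between homotopies and middle components\<close>

theorem proposition3p18:
  fixes R :: "('r, 's) ring_scheme"
    and A :: "('r, 'a) tw_data" and B :: "('r, 'b) tw_data"
    and f g :: "nat \<Rightarrow> ('a, 'b) bimap"
    and r :: nat
  assumes "cring R"
    and "twisted_complex R A" and "twisted_complex R B"
    and "twisted_morphism R A B f" and "twisted_morphism R A B g"
  shows "bij_betw (middle_component A)
    {h. r_homotopy R r A B f g h}
    {h'. (\<forall>m. h' m \<in> bigraded_maps R (piece A) (piece B) (- int m + int r) (- int m + int r - 1)) \<and>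
         (\<forall>m i j. \<forall>x\<in>carrier (piece A i j).
            (let T = piece B (i - int m + int r) (j - int m + int r) in
             (\<Oplus>\<^bsub>T\<^esub> k\<in>{..m}.
                [((-1::int) ^ (k + r))] \<cdot>\<^bsub>T\<^esub>
                   (dmap B k (i - int (m - k) + int r) (j - int (m - k) + int r - 1)
                     (h' (m - k) i j x))
                \<oplus>\<^bsub>T\<^esub> [((-1::int) ^ k)] \<cdot>\<^bsub>T\<^esub>
                   (h' k (i - int (m - k)) (j - int (m - k) + 1) (dmap A (m - k) i j x))) =
             (if m < r then \<zero>\<^bsub>T\<^esub> else g (m - r) i j x \<ominus>\<^bsub>T\<^esub> f (m - r) i j x)))}"
    (is "bij_betw _ ?H ?K")
proof -
  note A = assms(2) and B = assms(3) and f = assms(4) and g = assms(5)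
  \<comment> \<open>One equivalence serves both directions: its extensionality hypothesis holds for
    every \<open>middle_component\<close>, by restriction, and for every member of
    \<open>?K\<close>, whose maps are homomorphisms.\<close>
  have morphism: "twisted_morphism R A (path_complex r B) (path_family A f h' g) \<longleftrightarrow> h' \<in> ?K"
    if "\<And>m i j. restrict (h' m i j) (carrier (piece A i j)) = h' m i j" for h'
  proof -
    have maps: "path_family A f h' g m \<in> bigraded_maps R (piece A) (path_comp r B) (- int m) (- int m) \<longleftrightarrow>
        h' m \<in> bigraded_maps R (piece A) (piece B) (- int m + int r) (- int m + int r - 1)" for m
      by (rule path_family_bigraded_iff[where f = f and g = g and h' = h' and m = m,
            OF A twisted_morphism_map[OF f] twisted_morphism_map[OF g] that])
    show ?thesis
    \<comment> \<open>The equations can be compared only once the maps have the right bidegree. If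
      some map fails this, both sides of the equivalence are false.\<close>
    proof (cases "\<forall>m. h' m \<in> bigraded_maps R (piece A) (piece B) (- int m + int r) (- int m + int r - 1)")
      case True
      then show ?thesis
        using A path_complex_twisted[OF B, of r]
          path_family_equation_iff[OF f g True[rule_format] _ refl refl]
        by (simp add: twisted_morphism_def path_complex_def Let_def maps)
    next
      case False
      then show ?thesis
        by (auto simp: twisted_morphism_def path_complex_def maps)
    qed
  qed
  have maps: "h m \<in> bigraded_maps R (piece A) (path_comp r B) (- int m) (- int m)"
    if "twisted_morphism R A (path_complex r B) h" for h m
    using twisted_morphism_map[OF that] by (simp add: path_complex_def)
  have restrict_middle: "restrict (middle_component A h m i j) (carrier (piece A i j)) = middle_component A h m i j"
    for h :: "nat \<Rightarrow> ('a, 'b \<times> 'b \<times> 'b) bimap" and m i j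
    by (simp add: middle_component_def fun_eq_iff)
  have restrict_K: "restrict (h' m i j) (carrier (piece A i j)) = h' m i j" if "h' \<in> ?K" for h' m i j
    using that by (intro bigraded_map_restrict) auto
  \<comment> \<open>The end point conditions fix the outer entries of \<open>h\<close> on the
    carrier, and extensionality fixes its values elsewhere.\<close>
  have recover: "path_family A f (middle_component A h) g = h" if h: "r_homotopy R r A B f g h" for h
  proof (intro ext)
    fix m i j x
    have hm: "h m \<in> bigraded_maps R (piece A) (path_comp r B) (- int m) (- int m)" for m
      using h maps unfolding r_homotopy_def by blast
    have "f m i j = (\<lambda>x\<in>carrier (piece A i j). fst (h m i j x))"
      and "g m i j = (\<lambda>x\<in>carrier (piece A i j). snd (snd (h m i j x)))"
      using h twisted_compose_path_ends[OF B hm, of m i j] by (auto simp: r_homotopy_def)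
    then have "path_family A f (middle_component A h) g m i j x =
        restrict (h m i j) (carrier (piece A i j)) x"
      by (simp add: path_family_def middle_component_def case_prod_beta)
    then show "path_family A f (middle_component A h) g m i j x = h m i j x"
      by (simp add: bigraded_map_restrict[OF hm])
  qed
  show ?thesis
  proof (rule bij_betw_byWitness[where f' = "\<lambda>h'. path_family A f h' g"])
    show "\<forall>h\<in>?H. path_family A f (middle_component A h) g = h"
      using recover by blast
    show "\<forall>h'\<in>?K. middle_component A (path_family A f h' g) = h'"
    proof (intro ballI ext)
      fix h' m i j x assume "h' \<in> ?K"
      from fun_cong[OF restrict_K[OF this], of m i j x]
      show "middle_component A (path_family A f h' g) m i j x = h' m i j x"
        by (auto simp: middle_component_def path_family_def restrict_def split: if_splits)
    qed
    show "middle_component A ` ?H \<subseteq> ?K"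
    proof (rule image_subsetI)
      fix h assume "h \<in> ?H"
      then have "twisted_morphism R A (path_complex r B) (path_family A f (middle_component A h) g)"
        using recover[of h] by (simp add: r_homotopy_def)
      then show "middle_component A h \<in> ?K"
        using morphism[of "middle_component A h", OF restrict_middle] by blast
    qed
    show "(\<lambda>h'. path_family A f h' g) ` ?K \<subseteq> ?H"
    proof (rule image_subsetI)
      fix h' assume K: "h' \<in> ?K"
      then have mor: "twisted_morphism R A (path_complex r B) (path_family A f h' g)"
        using morphism[of h', OF restrict_K[OF K]] by blast
      \<comment> \<open>Composition with an end point returns \<open>f\<close> or \<open>g\<close>
        restricted to the carrier, which is the map itself because homomorphisms are
        extensional.\<close>
      have "twisted_compose A B (path_minus r B) (path_family A f h' g) m i j = f m i j"
        and "twisted_compose A B (path_plus r B) (path_family A f h' g) m i j = g m i j" for m i j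
        using bigraded_map_restrict[OF twisted_morphism_map[OF f], of m i j]
          bigraded_map_restrict[OF twisted_morphism_map[OF g], of m i j]
        by (simp_all add: twisted_compose_path_ends[OF B maps[OF mor]] path_family_def cong: restrict_cong)
      then show "path_family A f h' g \<in> ?H"
        using mor by (auto simp: r_homotopy_def fun_eq_iff)
    qed
  qed
qed

end
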